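(* Let $D=(V,A)$ be a digraph. Then $$EI(N\mathcal H(D))\cup \mathcal H'(D)=DC\mathcal H(D)\cup EI(C\mathcal H(D))\cup EI(CE\mathcal H(D)),$$ where the union of hypergraphs on the common vertex set $V$ is the hypergraph on $V$ whose edge set is the union of their edge sets.
   Context: For $v\in V$, $N_D^-(v)=\{u\in V:(u,v)\in A\}$ and $N_D^+(v)=\{u\in V:(v,u)\in A\}$. All hypergraphs below have vertex set $V$ and edge sets consisting of subsets $e\subseteq V$ with $|e|\ge 2$: competition hypergraph $C\mathcal H(D)$: $\mathcal E^C=\{e: |e|\ge2,\ \exists v\in V,\ e=N_D^-(v)\}$; common enemy hypergraph $CE\mathcal H(D)$: $\mathcal E^{CE}=\{e: |e|\ge2,\ \exists v\in V,\ e=N_D^+(v)\}$; double competition hypergraph $DC\mathcal H(D)$: $\mathcal E^{DC}=\{e: |e|\ge2,\ \exists v_1,v_2\in V,\ e=N_D^+(v_1)\cap N_D^-(v_2)\}$; niche hypergraph $N\mathcal H(D)$: $\mathcal E^N=\{e: |e|\ge2,\ \exists v\in V,\ e=N_D^-(v)\ \text{or}\ e=N_D^+(v)\}$; $\mathcal H'(D)$: edge set $\{e: |e|\ge2,\ \exists v_1,v_2\in V,\ e=N_D^-(v_1)=N_D^+(v_2)\}$. For a hypergraph $\mathcal H=(V,\mathcal E)$, its edge intersection hypergraph is $EI(\mathcal H)=(V,\mathcal E^{EI})$ with $\mathcal E^{EI}=\{e_1\cap e_2 \mid e_1,e_2\in\mathcal E,\ e_1\neq e_2,\ |e_1\cap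 e_2|\ge 2\}$. *)

theory Defs
  imports "Graph_Theory.Pair_Digraph"
begin

text \<open>
  A digraph \<open>D = (V, A)\<close> with \<open>A \<subseteq> V \<times> V\<close> is a \<open>pair_pre_digraph\<close> satisfying \<open>pair_wf_digraph\<close>.
  Loops are allowed, and \<open>V\<close> may be infinite.
\<close>

definition in_nbrs :: "'a pair_pre_digraph \<Rightarrow> 'a \<Rightarrow> 'a set" where
  "in_nbrs D v = {u \<in> pverts D. (u, v) \<in> parcs D}"

definition out_nbrs :: "'a pair_pre_digraph \<Rightarrow> 'a \<Rightarrow> 'a set" where
  "out_nbrs D v = {u \<in> pverts D. (v, u) \<in> parcs D}"

text \<open>
  \<open>|e| \<ge> 2\<close>. Infinite sets are treated separately, because \<open>card\<close> is \<open>0\<close> on them.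
\<close>

definition two_le_card :: "'a set \<Rightarrow> bool" where
  "two_le_card e \<longleftrightarrow> infinite e \<or> card e \<ge> 2"

record 'a hypergraph =
  hverts :: "'a set"
  hedges :: "'a set set"

definition wf_hypergraph :: "'a hypergraph \<Rightarrow> bool" where
  "wf_hypergraph H \<longleftrightarrow> (\<forall>e \<in> hedges H. e \<subseteq> hverts H \<and> two_le_card e)"

definition competition_hypergraph :: "'a pair_pre_digraph \<Rightarrow> 'a hypergraph" where
  "competition_hypergraph D =
     \<lparr> hverts = pverts D,
       hedges = {e. two_le_card e \<and> (\<exists>v \<in> pverts D. e = in_nbrs D v)} \<rparr>"

definition common_enemy_hypergraph :: "'a pair_pre_digraph \<Rightarrow> 'a hypergraph" where
  "common_enemy_hypergraph D =
     \<lparr> hverts = pverts D,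
       hedges = {e. two_le_card e \<and> (\<exists>v \<in> pverts D. e = out_nbrs D v)} \<rparr>"

definition double_competition_hypergraph :: "'a pair_pre_digraph \<Rightarrow> 'a hypergraph" where
  "double_competition_hypergraph D =
     \<lparr> hverts = pverts D,
       hedges = {e. two_le_card e \<and>
         (\<exists>v1 \<in> pverts D. \<exists>v2 \<in> pverts D. e = out_nbrs D v1 \<inter> in_nbrs D v2)} \<rparr>"

definition niche_hypergraph :: "'a pair_pre_digraph \<Rightarrow> 'a hypergraph" where
  "niche_hypergraph D =
     \<lparr> hverts = pverts D,
       hedges = {e. two_le_card e \<and> (\<exists>v \<in> pverts D. e = in_nbrs D v \<or> e = out_nbrs D v)} \<rparr>"

text \<open>The hypergraph written \<open>H'(D)\<close>, whose edges are both an in- and an out-neighbourhood.\<close>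

definition in_out_hypergraph :: "'a pair_pre_digraph \<Rightarrow> 'a hypergraph" where
  "in_out_hypergraph D =
     \<lparr> hverts = pverts D,
       hedges = {e. two_le_card e \<and>
         (\<exists>v1 \<in> pverts D. \<exists>v2 \<in> pverts D. e = in_nbrs D v1 \<and> in_nbrs D v1 = out_nbrs D v2)} \<rparr>"

definition edge_intersection_hypergraph :: "'a hypergraph \<Rightarrow> 'a hypergraph" where
  "edge_intersection_hypergraph H =
     \<lparr> hverts = hverts H,
       hedges = {e1 \<inter> e2 | e1 e2.
         e1 \<in> hedges H \<and> e2 \<in> hedges H \<and> e1 \<noteq> e2 \<and> two_le_card (e1 \<inter> e2)} \<rparr>"

definition hypergraph_union :: "'a hypergraph \<Rightarrow> 'a hypergraph \<Rightarrow> 'a hypergraph"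
    (infixl \<open>\<union>\<^sub>H\<close> 65) where
  "H1 \<union>\<^sub>H H2 = \<lparr> hverts = hverts H1 \<union> hverts H2, hedges = hedges H1 \<union> hedges H2 \<rparr>"

lemma in_nbrs_subset: "in_nbrs D v \<subseteq> pverts D"
  by (auto simp: in_nbrs_def)

lemma out_nbrs_subset: "out_nbrs D v \<subseteq> pverts D"
  by (auto simp: out_nbrs_def)

lemma wf_hypergraphs:
  "wf_hypergraph (competition_hypergraph D)"
  "wf_hypergraph (common_enemy_hypergraph D)"
  "wf_hypergraph (double_competition_hypergraph D)"
  "wf_hypergraph (niche_hypergraph D)"
  "wf_hypergraph (in_out_hypergraph D)"
  using in_nbrs_subset[of D] out_nbrs_subset[of D]
  by (auto simp: wf_hypergraph_def competition_hypergraph_def common_enemy_hypergraph_def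
      double_competition_hypergraph_def niche_hypergraph_def in_out_hypergraph_def dest: subsetD)

lemma wf_edge_intersection_hypergraph:
  "wf_hypergraph H \<Longrightarrow> wf_hypergraph (edge_intersection_hypergraph H)"
  by (auto simp: wf_hypergraph_def edge_intersection_hypergraph_def dest: subsetD)

lemma wf_hypergraph_union:
  "wf_hypergraph H1 \<Longrightarrow> wf_hypergraph H2 \<Longrightarrow> wf_hypergraph (H1 \<union>\<^sub>H H2)"
  by (auto simp: wf_hypergraph_def hypergraph_union_def dest: subsetD)

end

theory Submission
  imports Defs
begin

text \<open>The niche edges are the competition edges together with the common enemy edges, and the
  edges of \<open>H'(D)\<close> are those in both families. Two distinct niche edges are therefore
  two in-neighbourhoods, two out-neighbourhoods, or one of each. The first two kinds of pairs give
  the edge intersection hypergraphs on the right. The mixed kind gives the double competition edges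
  with distinct factors, and \<open>H'(D)\<close> supplies those with equal factors.
  \<open>hedges_double_competition_hypergraph\<close> and \<open>hedges_edge_intersection_Un\<close>
  carry this comparison.\<close>

lemma two_le_card_mono:
  assumes "two_le_card e" "e \<subseteq> f"
  shows "two_le_card f"
  using assms card_mono[of f e] finite_subset[of e f] by (auto simp: two_le_card_def)

lemma hedges_niche_hypergraph:
  "hedges (niche_hypergraph D) =
    hedges (competition_hypergraph D) \<union> hedges (common_enemy_hypergraph D)"
  by (auto simp: niche_hypergraph_def competition_hypergraph_def common_enemy_hypergraph_def)

lemma hedges_in_out_hypergraph:
  "hedges (in_out_hypergraph D) =
    hedges (competition_hypergraph D) \<inter> hedges (common_enemy_hypergraph D)"
  by (auto simp: in_out_hypergraph_def competition_hypergraph_def common_enemy_hypergraph_def)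

text \<open>The definition puts no size condition on the two neighbourhoods, but an intersection
  with at least two elements forces both to have at least two, so both are edges.\<close>

lemma hedges_double_competition_hypergraph:
  "hedges (double_competition_hypergraph D) =
    {e1 \<inter> e2 | e1 e2. e1 \<in> hedges (common_enemy_hypergraph D) \<and>
      e2 \<in> hedges (competition_hypergraph D) \<and> two_le_card (e1 \<inter> e2)}"
proof -
  have "two_le_card e \<and> two_le_card f" if "two_le_card (e \<inter> f)" for e f :: "'a set"
    using that two_le_card_mono by blast
  then show ?thesis
    unfolding double_competition_hypergraph_def competition_hypergraph_def
      common_enemy_hypergraph_def hypergraph.simps
    by blast
qed

text \<open>Pairs are sorted by the families of their members; \<open>H1\<close> and
  \<open>H2\<close> may overlap, since only a union is claimed. The mixed pairs take the
  \<open>H2\<close> edge first to match the order out-neighbourhood, in-neighbourhood in double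
  competition edges.\<close>

lemma hedges_edge_intersection_Un:
  assumes "hedges H = hedges H1 \<union> hedges H2"
  shows "hedges (edge_intersection_hypergraph H) =
    hedges (edge_intersection_hypergraph H1) \<union> hedges (edge_intersection_hypergraph H2) \<union>
    {e1 \<inter> e2 | e1 e2.
      e1 \<in> hedges H2 \<and> e2 \<in> hedges H1 \<and> e1 \<noteq> e2 \<and> two_le_card (e1 \<inter> e2)}"
    (is "?L = ?R")
proof
  show "?L \<subseteq> ?R"
  proof
    fix e assume "e \<in> ?L"
    \<comment> \<open>Both orders are recorded so that the last case below follows by exchanging
      \<open>e1\<close> and \<open>e2\<close>.\<close>
    then obtain e1 e2 where e: "e = e1 \<inter> e2" "e = e2 \<inter> e1"
      "e1 \<in> hedges H1 \<union> hedges H2" "e2 \<in> hedges H1 \<union> hedges H2"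
      "e1 \<noteq> e2" "e2 \<noteq> e1" "two_le_card e"
      by (auto simp: edge_intersection_hypergraph_def assms Int_commute)
    from e(3,4) consider "e1 \<in> hedges H1" "e2 \<in> hedges H1" | "e1 \<in> hedges H2" "e2 \<in> hedges H2"
      | "e1 \<in> hedges H2" "e2 \<in> hedges H1" | "e2 \<in> hedges H2" "e1 \<in> hedges H1"
      by blast
    then show "e \<in> ?R"
    proof cases
      case 1 with e show ?thesis by (auto simp: edge_intersection_hypergraph_def)
    next
      case 2 with e show ?thesis by (auto simp: edge_intersection_hypergraph_def)
    next
      case 3 with e(1,5,7) show ?thesis by blast
    next
      case 4 with e(2,6,7) show ?thesis by blast
    qed
  qed
  show "?R \<subseteq> ?L"
    by (auto simp: edge_intersection_hypergraph_def assms)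
qed

theorem theorem2:
  fixes D :: "'a pair_pre_digraph"
  assumes "pair_wf_digraph D"
  shows "edge_intersection_hypergraph (niche_hypergraph D) \<union>\<^sub>H in_out_hypergraph D =
    double_competition_hypergraph D
      \<union>\<^sub>H edge_intersection_hypergraph (competition_hypergraph D)
      \<union>\<^sub>H edge_intersection_hypergraph (common_enemy_hypergraph D)"
proof -
  let ?C = "hedges (competition_hypergraph D)" and ?E = "hedges (common_enemy_hypergraph D)"
  let ?mixed = "{e1 \<inter> e2 | e1 e2.
    e1 \<in> ?E \<and> e2 \<in> ?C \<and> e1 \<noteq> e2 \<and> two_le_card (e1 \<inter> e2)}"
  \<comment> \<open>This gives the size condition when an edge \<open>e\<close> of
    \<open>H'(D)\<close> is written as \<open>e \<inter> e\<close>.\<close>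
  have "two_le_card e" if "e \<in> ?C" for e
    using that by (simp add: competition_hypergraph_def)
  \<comment> \<open>The case \<open>e1 = e2\<close> of a double competition edge is exactly an edge of \<open>H'(D)\<close>.\<close>
  then have "hedges (double_competition_hypergraph D) = ?mixed \<union> hedges (in_out_hypergraph D)"
    unfolding hedges_double_competition_hypergraph hedges_in_out_hypergraph
    by auto (metis Int_absorb)+
  then have "hedges (edge_intersection_hypergraph (niche_hypergraph D)) \<union>
      hedges (in_out_hypergraph D) =
    hedges (double_competition_hypergraph D) \<union>
      hedges (edge_intersection_hypergraph (competition_hypergraph D)) \<union>
      hedges (edge_intersection_hypergraph (common_enemy_hypergraph D))"
    unfolding hedges_edge_intersection_Un[OF hedges_niche_hypergraph] by blast
  moreover have "hverts (edge_intersection_hypergraph (niche_hypergraph D)) = pverts D"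
    "hverts (in_out_hypergraph D) = pverts D"
    "hverts (double_competition_hypergraph D) = pverts D"
    "hverts (edge_intersection_hypergraph (competition_hypergraph D)) = pverts D"
    "hverts (edge_intersection_hypergraph (common_enemy_hypergraph D)) = pverts D"
    by (simp_all add: edge_intersection_hypergraph_def niche_hypergraph_def in_out_hypergraph_def
        double_competition_hypergraph_def competition_hypergraph_def common_enemy_hypergraph_def)
  ultimately show ?thesis
    by (simp add: hypergraph_union_def)
qed

end
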